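(* Let $n\ge1$ and $k\ge 1$ be integers and let $x=[n,n,\ldots,n]$ be the finite regular continued fraction with $k$ entries, all equal to $n$. Then the radius of convergence of the Taylor series at $q=0$ of $[x]_q$ (in the complex variable $q$) is greater than or equal to $R_{(1)}=\frac{3-\sqrt5}{2}$.
   Context: **Regular continued fractions.** $[a_1,a_2,\ldots,a_k]=a_1+\cfrac{1}{a_2+\cfrac{1}{\ddots+\cfrac{1}{a_k}}}$ with integers $a_i\ge 1$. Since $[a_1,\ldots,a_k]=[a_1,\ldots,a_k-1,1]$ (when $a_k\ge2$) and $[a_1,\ldots,a_{k-1},1]=[a_1,\ldots,a_{k-1}+1]$, every rational number $>1$ has a unique such expansion of even length $2m$. **$q$-integers.** $[0]_q=0$ and $[a]_q=1+q+\cdots+q^{a-1}$ for an integer $a\ge1$; $[a]_{q^{-1}}=1+q^{-1}+\cdots+q^{-(a-1)}$. **$q$-rationals (Morier-Genoud and Ovsienko).** For a rational $\frac rs=[a_1,\ldots,a_{2m}]>1$ (even-length expansion), $$\left[\frac rs\right]_q=[a_1]_q+\cfrac{q^{a_1}}{[a_2]_{q^{-1}}+\cfrac{q^{-a_2}}{[a_3]_q+\cfrac{q^{a_3}}{[a_4]_{q^{-1}}+\cfrac{q^{-a_4}}{\ddots+\cfrac{q^{a_{2m-1}}}{[a_{2m}]_{q^{-1}}}}}}},$$ a rational function of $q$, regarded as a power series in $q$ via its Taylor expansion at $q=0$. (For a positive integer this gives the $q$-integer; $[1]_q=1$.) The radius of convergence is $+\infty$ if $[x]_q$ is a polynomial.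 *)

theory Defs
  imports
    "HOL-Analysis.FPS_Convergence"
    "HOL-Computational_Algebra.Normalized_Fraction"
    "HOL-Computational_Algebra.Polynomial_Factorial"
    "HOL-Computational_Algebra.Field_as_Ring"
begin

section \<open>Regular continued fractions\<close>

fun reg_cf :: "nat list \<Rightarrow> rat" where
  "reg_cf [] = 0"
| "reg_cf [a] = of_nat a"
| "reg_cf (a # b # as) = of_nat a + 1 / reg_cf (b # as)"

definition is_even_expansion :: "rat \<Rightarrow> nat list \<Rightarrow> bool" where
  "is_even_expansion x as \<longleftrightarrow>
     as \<noteq> [] \<and> even (length as) \<and> (\<forall>a\<in>set as. a \<ge> 1) \<and> reg_cf as = x"

text \<open>Only meaningful for \<open>x > 1\<close>; see \<open>even_expansion_exists_unique\<close> below.\<close>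

definition even_expansion :: "rat \<Rightarrow> nat list" where
  "even_expansion x = (THE as. is_even_expansion x as)"

lemma reg_cf_ge_1:
  assumes "as \<noteq> []" "\<forall>a\<in>set as. a \<ge> 1"
  shows "reg_cf as \<ge> 1"
  using assms
proof (induction as rule: reg_cf.induct)
  case (3 a b as)
  have "reg_cf (b # as) \<ge> 1" using 3 by auto
  moreover have "(of_nat a :: rat) \<ge> 1" using 3 by simp
  ultimately show ?case by (simp add: add_increasing2)
qed auto

lemma reg_cf_eq_1D:
  assumes "as \<noteq> []" "\<forall>a\<in>set as. a \<ge> 1" "reg_cf as = 1"
  shows "as = [1]"
  using assms
proof (cases as rule: reg_cf.cases)
  case (3 a b bs)
  have "reg_cf (b # bs) \<ge> 1" using 3 assms by (intro reg_cf_ge_1) auto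
  hence "1 / reg_cf (b # bs) > 0" by simp
  moreover have "(of_nat a :: rat) \<ge> 1" using 3 assms by simp
  moreover have "of_nat a + 1 / reg_cf (b # bs) = 1"
    using assms(3) unfolding 3 reg_cf.simps .
  ultimately show ?thesis by linarith
qed auto

lemma nat_plus_inverse_unique:
  fixes s t :: rat
  assumes "of_nat a + 1 / s = of_nat b + 1 / t" "s \<ge> 1" "t \<ge> 1"
  shows "a = b \<and> s = t"
proof -
  have *: "0 < 1 / s" "1 / s \<le> 1" "0 < 1 / t" "1 / t \<le> 1" using assms by auto
  have "(of_nat a :: rat) < of_nat b + 1" "(of_nat b :: rat) < of_nat a + 1"
    using * assms(1) by linarith+
  hence "(of_nat a :: rat) < of_nat (b + 1)" "(of_nat b :: rat) < of_nat (a + 1)" by simp_all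
  hence "a = b" unfolding of_nat_less_iff by simp
  thus ?thesis using assms by simp
qed

lemma reg_cf_inject:
  assumes "as \<noteq> []" "\<forall>a\<in>set as. a \<ge> 1" "bs \<noteq> []" "\<forall>b\<in>set bs. b \<ge> 1"
    and "even (length as) = even (length bs)" "reg_cf as = reg_cf bs"
  shows "as = bs"
proof -
  have aux: False if "cs \<noteq> []" "\<forall>c\<in>set cs. c \<ge> 1" "even (length cs)"
    "of_nat a = of_nat d + 1 / reg_cf cs" for a d cs
  proof -
    have "reg_cf cs \<ge> 1" "reg_cf cs \<noteq> 1"
      using that reg_cf_ge_1[of cs] reg_cf_eq_1D[of cs] by auto
    hence *: "0 < 1 / reg_cf cs" "1 / reg_cf cs < 1" by auto
    hence "(of_nat d :: rat) < of_nat a" "(of_nat a :: rat) < of_nat d + 1"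
      using that(4) by linarith+
    hence "(of_nat d :: rat) < of_nat a" "(of_nat a :: rat) < of_nat (d + 1)" by simp_all
    thus False unfolding of_nat_less_iff by simp
  qed
  show ?thesis using assms
  proof (induction as arbitrary: bs rule: reg_cf.induct)
    case (2 a)
    show ?case
    proof (cases bs rule: reg_cf.cases)
      case (3 b c cs)
      have "of_nat a = of_nat b + 1 / reg_cf (c # cs)"
        using "2.prems"(6) unfolding 3 reg_cf.simps .
      moreover have "\<forall>c\<in>set (c # cs). c \<ge> 1" "even (length (c # cs))"
        using "2.prems"(4,5) unfolding 3 by simp_all
      ultimately show ?thesis using aux[of "c # cs" a b] by blast
    qed (use 2 in auto)
  next
    case (3 a c cs)
    show ?case
    proof (cases bs rule: reg_cf.cases)
      case (2 b)
      have "of_nat b = of_nat a + 1 / reg_cf (c # cs)"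
        using "3.prems"(6) unfolding 2 reg_cf.simps by (rule sym)
      moreover have "\<forall>c\<in>set (c # cs). c \<ge> 1" "even (length (c # cs))"
        using "3.prems"(2,5) unfolding 2 by simp_all
      ultimately show ?thesis using aux[of "c # cs" b a] by blast
    next
      case 4: (3 b d ds)
      have entries: "\<forall>c\<in>set (c # cs). c \<ge> 1" "\<forall>d\<in>set (d # ds). d \<ge> 1"
        and parity: "even (length (c # cs)) = even (length (d # ds))"
        using "3.prems"(2,4,5) unfolding 4 by simp_all
      have "of_nat a + 1 / reg_cf (c # cs) = of_nat b + 1 / reg_cf (d # ds)"
        using "3.prems"(6) unfolding 4 reg_cf.simps .
      hence eq: "a = b \<and> reg_cf (c # cs) = reg_cf (d # ds)"
        using entries by (intro nat_plus_inverse_unique reg_cf_ge_1) simp_all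
      hence "c # cs = d # ds"
        using entries parity by (intro "3.IH") simp_all
      thus ?thesis using eq unfolding 4 by simp
    qed (use "3.prems" in simp_all)
  qed auto
qed

lemma reg_cf_Cons: "as \<noteq> [] \<Longrightarrow> reg_cf (a # as) = of_nat a + 1 / reg_cf as"
  by (cases as) auto

lemma reg_cf_exists:
  fixes p q :: nat
  assumes "q > 0" "p \<ge> q" "e \<longrightarrow> p > q"
  shows "\<exists>as. as \<noteq> [] \<and> even (length as) = e \<and> (\<forall>a\<in>set as. a \<ge> 1) \<and>
           reg_cf as = of_nat p / of_nat q"
  using assms
proof (induction q arbitrary: p e rule: less_induct)
  case (less q)
  define a r where "a = p div q" and "r = p mod q"
  have p: "p = a * q + r" by (simp add: a_def r_def)
  have r: "r < q" using less.prems(1) by (simp add: r_def)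
  have a: "a \<ge> 1"
  proof (rule ccontr)
    assume "\<not> a \<ge> 1"
    hence "a = 0" by simp
    hence "p = r" using p by simp
    thus False using r less.prems(2) by simp
  qed
  have q: "(of_nat q :: rat) \<noteq> 0" using less.prems(1) by simp
  have p': "(of_nat p :: rat) = of_nat a * of_nat q + of_nat r" by (simp add: p)
  have eq: "of_nat p / of_nat q = of_nat a + (of_nat r / of_nat q :: rat)"
    unfolding p' add_divide_distrib using q by simp
  show ?case
  proof (cases "r = 0")
    case True
    have eq: "of_nat p / of_nat q = (of_nat a :: rat)" using eq True by simp
    show ?thesis
    proof (cases e)
      case False
      thus ?thesis unfolding eq using a by (intro exI[of _ "[a]"]) simp
    next
      case e: True
      have "a \<noteq> 1"
      proof
        assume "a = 1"
        hence "p = q" using p True by simp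
        thus False using less.prems(3) e by simp
      qed
      hence "a - 1 \<ge> 1" using a by linarith
      thus ?thesis unfolding eq using a e
        by (intro exI[of _ "[a - 1, 1]"]) (simp add: of_nat_diff)
    qed
  next
    case False
    have "\<exists>as. as \<noteq> [] \<and> even (length as) = (\<not> e) \<and> (\<forall>a\<in>set as. a \<ge> 1) \<and>
            reg_cf as = of_nat q / of_nat r"
      using r False by (intro less.IH) simp_all
    then obtain as where as: "as \<noteq> []" "even (length as) = (\<not> e)" "\<forall>a\<in>set as. a \<ge> 1"
      "reg_cf as = of_nat q / of_nat r"
      by blast
    have "reg_cf (a # as) = of_nat p / of_nat q"
      unfolding reg_cf_Cons[OF as(1)] as(4) eq by simp
    moreover have "even (length (a # as)) = e" using as(2) by simp
    moreover have "\<forall>x\<in>set (a # as). x \<ge> 1" using as(3) a by simp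
    ultimately show ?thesis by blast
  qed
qed

lemma even_expansion_exists_unique:
  assumes "x > 1"
  shows "\<exists>!as. is_even_expansion x as"
proof -
  obtain p q :: int where pq: "q > 0" "x = of_int p / of_int q"
    by (cases "quotient_of x") (use quotient_of_div quotient_of_denom_pos in blast)
  have "p > q" using assms pq by (simp add: field_simps)
  hence "x = of_nat (nat p) / of_nat (nat q)" "nat q > 0" "nat p > nat q"
    using pq by (auto simp: of_nat_nat)
  hence "\<exists>as. is_even_expansion x as"
    using reg_cf_exists[of "nat q" "nat p" True] by (auto simp: is_even_expansion_def)
  moreover have "as = bs" if "is_even_expansion x as" "is_even_expansion x bs" for as bs
    using that by (intro reg_cf_inject) (auto simp: is_even_expansion_def)
  ultimately show ?thesis by blast
qed

section \<open>\<open>q\<close>-rationals\<close>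

definition q_int :: "'a::field \<Rightarrow> nat \<Rightarrow> 'a" where
  "q_int q a = (\<Sum>i<a. q ^ i)"

text \<open>
  Passing to the next level replaces \<open>q\<close> by \<open>q\<inverse>\<close>, so the levels alternate between
  \<open>[a]\<^sub>q\<close>, \<open>q ^ a\<close> and their counterparts in \<open>q\<inverse>\<close>.
\<close>

fun q_cf :: "'a::field \<Rightarrow> nat list \<Rightarrow> 'a" where
  "q_cf q [] = 0"
| "q_cf q [a] = q_int q a"
| "q_cf q (a # b # as) = q_int q a + q ^ a / q_cf (inverse q) (b # as)"

text \<open>
  The \<open>q\<close>-rational as an element of the field of rational functions over the complex numbers,
  the indeterminate \<open>q\<close> being the polynomial \<open>[:0, 1:]\<close>.  The number 1 has no
  expansion of positive even length.
\<close>

definition q_rational :: "rat \<Rightarrow> complex poly fract" where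
  "q_rational x = (if x = 1 then 1 else q_cf (to_fract [:0, 1:]) (even_expansion x))"

text \<open>
  Taylor expansion at 0: the pair \<open>(P, Q)\<close> is in lowest terms, so the rational function is
  regular at 0 iff \<open>Q\<close> has nonzero constant term, and then the quotient of power series
  is its Taylor series.  (If there is a pole at 0, the value is meaningless.)
\<close>

definition taylor_fract :: "complex poly fract \<Rightarrow> complex fps" where
  "taylor_fract f = (case quot_of_fract f of (P, Q) \<Rightarrow> fps_of_poly P / fps_of_poly Q)"

end

theory Submission
  imports Defs "HOL-Complex_Analysis.Cauchy_Integral_Formula"
begin

text \<open>
  The denominators \<open>D\<^sub>j\<close> of the \<open>q\<close>-rationals of \<open>[n, \<dots>, n]\<close>, for lengths of a fixed parity, satisfy
  \<open>D\<^sub>j\<^sub>+\<^sub>2 = T D\<^sub>j\<^sub>+\<^sub>1 - q\<^sup>2\<^sup>n D\<^sub>j\<close> with \<open>T = 1 + q [n]\<^sub>q\<^sup>2 + q\<^sup>2\<^sup>n\<close>.  Hence at a zero of a denominator,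
  \<open>T / q\<^sup>n\<close> is an eigenvalue of the adjacency matrix of a path with a loop of weight \<open>0\<close> or \<open>q\<^sup>n\<close> at one
  end, and taking the Rayleigh quotient gives \<open>T = q\<^sup>n (t + s q\<^sup>n)\<close> with real \<open>s \<ge> 0\<close> and \<open>\<bar>t\<bar> \<le> 2 - s\<close>.
  For \<open>n = 1\<close> and \<open>\<bar>q\<bar> < 1\<close> this forces \<open>q\<close> to be real with \<open>1 - 3 \<bar>q\<bar> + q\<^sup>2 \<le> 0\<close>.  For \<open>n \<ge> 2\<close> it gives
  \<open>\<bar>T\<bar> \<le> 2 \<bar>q\<bar>\<^sup>n\<close>, which is impossible for small \<open>q\<close> because
  \<open>(1 - q)\<^sup>2 T = (1 - q + q\<^sup>2) (1 + q\<^sup>2\<^sup>n) - 2 q\<^sup>n\<^sup>+\<^sup>1\<close>.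
\<close>

section \<open>Continued fraction expansions of either parity\<close>

lemma q_cf_Cons:
  "bs \<noteq> [] \<Longrightarrow> q_cf q (a # bs) = q_int q a + q ^ a / q_cf (inverse q) bs"
  by (cases bs) auto

lemma reg_cf_append_1: "reg_cf (as @ [a, 1]) = reg_cf (as @ [Suc a])"
  by (induction as) (simp_all add: reg_cf_Cons)

lemma q_cf_append_1: "q_cf q (as @ [a, 1]) = q_cf q (as @ [Suc a])"
  by (induction as arbitrary: q) (simp_all add: q_cf_Cons q_int_def)

lemma even_expansion_reg_cf:
  assumes "as \<noteq> []" "\<forall>a\<in>set as. a \<ge> 1" "even (length as)"
  shows "even_expansion (reg_cf as) = as"
proof -
  have "reg_cf as \<ge> 1" "reg_cf as \<noteq> 1"
    using reg_cf_ge_1[of as] reg_cf_eq_1D[of as] assms by auto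
  hence "\<exists>!bs. is_even_expansion (reg_cf as) bs"
    by (intro even_expansion_exists_unique) simp
  moreover have "is_even_expansion (reg_cf as) as"
    using assms by (simp add: is_even_expansion_def)
  ultimately show ?thesis
    unfolding even_expansion_def by (rule the1_equality)
qed

text \<open>An odd-length list becomes even by splitting a last entry \<open>Suc b\<close> into
  \<open>b, 1\<close>, or by merging a last entry 1 into its predecessor. Neither move changes the
  ordinary or the q-value. Only \<open>[1]\<close> admits no such move, and there the convention for
  \<open>x = 1\<close> applies.\<close>

lemma q_rational_reg_cf:
  assumes "as \<noteq> []" "\<forall>a\<in>set as. a \<ge> 1"
  shows "q_rational (reg_cf as) = q_cf (to_fract [:0, 1:]) as"
proof (cases "reg_cf as = 1")
  case True
  hence "as = [1]" using assms by (intro reg_cf_eq_1D)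
  thus ?thesis by (simp add: q_rational_def q_int_def)
next
  case False
  have "\<exists>bs. bs \<noteq> [] \<and> (\<forall>b\<in>set bs. b \<ge> 1) \<and> even (length bs) \<and> reg_cf bs = reg_cf as \<and>
          q_cf (to_fract [:0, 1::complex:]) bs = q_cf (to_fract [:0, 1:]) as"
  proof (cases "even (length as)")
    case False
    obtain cs a where as: "as = cs @ [a]"
      using assms(1) by (metis append_butlast_last_id)
    show ?thesis
    proof (cases "a = 1")
      case True
      with \<open>reg_cf as \<noteq> 1\<close> have "cs \<noteq> []" using as by auto
      then obtain ds b where cs: "cs = ds @ [b]"
        by (metis append_butlast_last_id)
      show ?thesis
        using assms False reg_cf_append_1[of ds b] q_cf_append_1[of "to_fract [:0, 1 :: complex:]" ds b]
        by (intro exI[of _ "ds @ [Suc b]"]) (auto simp: as cs True)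
    next
      case a: False
      with assms obtain b where b: "a = Suc b" "b \<ge> 1"
        by (cases a) (auto simp: as)
      show ?thesis
        using assms False reg_cf_append_1[of cs b] q_cf_append_1[of "to_fract [:0, 1 :: complex:]" cs b] b
        by (intro exI[of _ "cs @ [b, 1]"]) (auto simp: as)
    qed
  qed (use assms in blast)
  then obtain bs where "bs \<noteq> []" "\<forall>b\<in>set bs. b \<ge> 1" "even (length bs)"
    and eq: "reg_cf bs = reg_cf as" 
      "q_cf (to_fract [:0, 1::complex:]) bs = q_cf (to_fract [:0, 1:]) as"
    by blast
  hence "even_expansion (reg_cf as) = bs" using even_expansion_reg_cf[of bs] by simp
  thus ?thesis using False eq by (simp add: q_rational_def)
qed

section \<open>Convergents with constant entries\<close>

text \<open>Unlike \<open>q_int\<close>, this makes sense over any commutative ring, so convergents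
  can be formed over polynomials, fractions and complex numbers alike.\<close>

definition geom :: "'a::comm_ring_1 \<Rightarrow> nat \<Rightarrow> 'a" where
  "geom q n = (\<Sum>i<n. q ^ i)"

text \<open>
  Prepending two entries \<open>n\<close> acts on the value \<open>f\<close> of a \<open>q\<close>-continued fraction by the
  fractional linear map \<open>f \<mapsto> (N + (q N\<^sup>2 + q\<^sup>2\<^sup>n) f) / (1 + q N f)\<close> with \<open>N = [n]\<^sub>q\<close>; here it acts on pairs
  (numerator, denominator).
\<close>

definition cf_step :: "'a::comm_ring_1 \<Rightarrow> nat \<Rightarrow> 'a \<times> 'a \<Rightarrow> 'a \<times> 'a" where
  "cf_step q n = (\<lambda>(P, D). (geom q n * D + (q * geom q n ^ 2 + q ^ (2 * n)) * P,
                            D + q * geom q n * P))"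

text \<open>From \<open>[n]\<^sub>q = N\<close> and \<open>[n, n]\<^sub>q = N + q\<^sup>2\<^sup>n\<^sup>-\<^sup>1 / N\<close>.\<close>

definition cf_start :: "'a::comm_ring_1 \<Rightarrow> nat \<Rightarrow> bool \<Rightarrow> 'a \<times> 'a" where
  "cf_start q n e = (if e then (geom q n ^ 2 + q ^ (2 * n - 1), geom q n) else (geom q n, 1))"

definition cf_iter :: "'a::comm_ring_1 \<Rightarrow> nat \<Rightarrow> bool \<Rightarrow> nat \<Rightarrow> 'a \<times> 'a" where
  "cf_iter q n e j = (cf_step q n ^^ j) (cf_start q n e)"

lemma cf_iter_0: "cf_iter q n e 0 = cf_start q n e"
  and cf_iter_Suc: "cf_iter q n e (Suc j) = cf_step q n (cf_iter q n e j)"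
  by (simp_all add: cf_iter_def)

text \<open>Applied to evaluation at a point and to the embedding into fractions, this links the
  three instances of \<open>cf_iter\<close>.\<close>

lemma cf_iter_hom:
  fixes h :: "'a::comm_ring_1 \<Rightarrow> 'b::comm_ring_1"
  assumes add: "\<And>x y. h (x + y) = h x + h y" and mult: "\<And>x y. h (x * y) = h x * h y"
    and one: "h 1 = 1"
  shows "cf_iter (h q) n e j = map_prod h h (cf_iter q n e j)"
proof -
  have "h 0 = 0" using add[of 0 0] by simp
  have pow: "h (x ^ i) = h x ^ i" for x i by (induction i) (simp_all add: mult one)
  have geom: "geom (h q) m = h (geom q m)" for m
    using \<open>h 0 = 0\<close> by (induction m) (simp_all add: geom_def add pow)
  show ?thesis
    by (induction j)
       (auto simp: cf_iter_0 cf_iter_Suc cf_start_def cf_step_def add mult one pow geom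
             split: prod.splits)
qed

lemma cf_iter_poly:
  "cf_iter z n e j =
     (poly (fst (cf_iter [:0, 1:] n e j)) z, poly (snd (cf_iter [:0, 1:] n e j)) z)"
  using cf_iter_hom[of "\<lambda>p. poly p z" "[:0, 1:]" n e j] by (simp add: map_prod_def split_beta)

lemma cf_iter_to_fract:
  "cf_iter (to_fract q) n e j =
     (to_fract (fst (cf_iter q n e j)), to_fract (snd (cf_iter q n e j)))"
  using cf_iter_hom[of to_fract q n e j] by (simp add: map_prod_def split_beta)

lemma geom_0: "n \<ge> 1 \<Longrightarrow> geom 0 n = 1"
  by (cases n) (simp_all add: geom_def sum.lessThan_Suc_shift del: sum.lessThan_Suc)

lemma cf_iter_at_0: "n \<ge> 1 \<Longrightarrow> cf_iter 0 n e j = (1, 1)"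
  by (induction j)
     (simp_all add: cf_iter_0 cf_iter_Suc cf_start_def cf_step_def geom_0 power_0_left)

text \<open>Constant term 1 makes every numerator and denominator a nonzero polynomial, as the
  divisions in \<open>q_cf_replicate\<close> require.\<close>

lemma poly_cf_iter_0:
  fixes n :: nat
  assumes "n \<ge> 1"
  shows "poly (fst (cf_iter [:0, 1 :: 'a::comm_ring_1:] n e j)) 0 = 1"
    "poly (snd (cf_iter [:0, 1 :: 'a:] n e j)) 0 = 1"
  using cf_iter_poly[of "0 :: 'a" n e j] cf_iter_at_0[OF assms, where 'a = 'a] by simp_all

lemma q_int_eq_geom: "q_int q n = geom q n"
  by (simp add: q_int_def geom_def)

lemma q_int_inverse:
  assumes "q \<noteq> 0"
  shows "q_int (inverse q) n = q * geom q n / q ^ n"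
proof (induction n)
  case (Suc n)
  have "geom q (Suc n) = 1 + q * geom q n"
    unfolding geom_def by (subst sum.lessThan_Suc_shift) (simp add: sum_distrib_left)
  thus ?case using Suc assms by (simp add: q_int_def field_simps)
qed (simp_all add: q_int_def geom_def)

lemma q_cf_replicate:
  fixes q :: "'a::field"
  assumes "q \<noteq> 0" "n \<ge> 1" and nz: "\<And>j. fst (cf_iter q n e j) \<noteq> 0"
    "\<And>j. snd (cf_iter q n e j) \<noteq> 0"
  shows "q_cf q (replicate (2 * j + (if e then 2 else 1)) n) =
           fst (cf_iter q n e j) / snd (cf_iter q n e j)"
proof (induction j)
  case 0
  show ?case
  proof (cases e)
    case True
    have "geom q n \<noteq> 0" using nz(2)[of 0] True by (simp add: cf_iter_0 cf_start_def)
    moreover have "q ^ n * q ^ n = q * q ^ (2 * n - 1)"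
      using \<open>n \<ge> 1\<close> by (simp add: mult_2 flip: power_add power_Suc)
    ultimately show ?thesis using assms(1) True
      by (simp add: numeral_2_eq_2 cf_iter_0 cf_start_def q_int_eq_geom[of q] q_int_inverse)
         (simp add: field_simps power2_eq_square)
  qed (simp add: cf_iter_0 cf_start_def q_int_eq_geom)
next
  case (Suc j)
  obtain P D where PD: "cf_iter q n e j = (P, D)" by fastforce
  define N where "N = geom q n"
  define r where "r = replicate (2 * j + (if e then 2 else 1)) n"
  have PD_nz: "P \<noteq> 0" "D \<noteq> 0" using nz[of j] PD by simp_all
  have step: "cf_iter q n e (Suc j) = (N * D + (q * N ^ 2 + q ^ (2 * n)) * P, D + q * N * P)"
    by (simp add: cf_iter_Suc PD cf_step_def N_def)
  hence D': "D + q * N * P \<noteq> 0" using nz(2)[of "Suc j"] by simp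
  have "r \<noteq> []" by (simp add: r_def)
  have val: "q_cf q r = P / D" using Suc PD by (simp add: r_def)
  have "q_cf (inverse q) (n # r) = q * N / q ^ n + inverse q ^ n / (P / D)"
    using \<open>r \<noteq> []\<close> assms(1) by (simp add: q_cf_Cons val q_int_inverse N_def)
  also have "\<dots> = (D + q * N * P) / (q ^ n * P)"
    using PD_nz assms(1) by (simp add: field_simps)
  finally have "q_cf q (n # n # r) = N + q ^ n / ((D + q * N * P) / (q ^ n * P))"
    by (simp add: q_int_eq_geom[of q] N_def)
  also have "\<dots> = (N * D + (q * N ^ 2 + q ^ (2 * n)) * P) / (D + q * N * P)"
    using D' by (simp add: field_simps power2_eq_square) (simp add: mult_2_right power_add)
  finally show ?case by (simp add: r_def step)
qed

text \<open>By Cayley--Hamilton for the matrix of \<^const>\<open>cf_step\<close>, whose determinant is \<open>q\<^sup>2\<^sup>n\<close>.\<close>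

lemma cf_iter_denom_recurrence:
  fixes q :: "'a::comm_ring_1" and n :: nat
  defines "T \<equiv> 1 + q * geom q n ^ 2 + q ^ (2 * n)"
  shows "snd (cf_iter q n e (Suc (Suc j))) =
           T * snd (cf_iter q n e (Suc j)) - q ^ (2 * n) * snd (cf_iter q n e j)"
  unfolding cf_iter_Suc T_def cf_step_def by (simp add: split_beta algebra_simps power2_eq_square)

section \<open>Zeros of the denominators\<close>

text \<open>
  The vector \<open>(d\<^sub>0, \<dots>, d\<^sub>m\<^sub>-\<^sub>1)\<close> is an eigenvector, with eigenvalue \<open>\<tau>\<close>, of the adjacency matrix of a path
  with a loop of weight \<open>\<alpha>\<close> at its first vertex; \<open>t + s \<alpha>\<close> is its Rayleigh quotient.
\<close>

lemma path_eigenvalue: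
  fixes d :: "nat \<Rightarrow> complex" and \<tau> \<alpha> :: complex
  assumes d0: "d 0 \<noteq> 0" and d1: "d (Suc 0) = (\<tau> - \<alpha>) * d 0"
    and rec: "\<And>j. d (Suc (Suc j)) = \<tau> * d (Suc j) - d j" and zero: "d m = 0"
  obtains t s :: real where "\<tau> = of_real t + of_real s * \<alpha>" "s \<ge> 0" "\<bar>t\<bar> \<le> 2 - s"
proof -
  define S where "S i = (\<Sum>j\<le>i. cmod (d j) ^ 2)" for i
  \<comment> \<open>Multiply the recurrence by \<open>cnj (d j)\<close> and sum over
    \<open>j\<close>. Neighbouring products pair up to twice their real parts, collected in
    \<open>X\<close>; only the boundary term \<open>d (Suc i) * cnj (d i)\<close> stays unpaired,
    and it vanishes when \<open>d (Suc i) = 0\<close>. The bound uses 2ab <= a^2 + b^2, counting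
    each end of the path once and inner vertices twice.\<close>
  have *: "\<exists>X::real. \<tau> * of_real (S i) = \<alpha> * of_real (cmod (d 0) ^ 2) + of_real X + d (Suc i) * cnj (d i)
             \<and> \<bar>X\<bar> \<le> 2 * S i - cmod (d 0) ^ 2 - cmod (d i) ^ 2" for i
  proof (induction i)
    case 0
    have "(\<tau> - \<alpha>) * of_real (cmod (d 0) ^ 2) = d (Suc 0) * cnj (d 0)"
      unfolding d1 complex_norm_square by simp
    thus ?case by (intro exI[of _ 0]) (simp add: S_def algebra_simps)
  next
    case (Suc i)
    then obtain X where X: "\<tau> * of_real (S i) = \<alpha> * of_real (cmod (d 0) ^ 2) + of_real X + d (Suc i) * cnj (d i)"
      "\<bar>X\<bar> \<le> 2 * S i - cmod (d 0) ^ 2 - cmod (d i) ^ 2" by blast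
    define Y where "Y = 2 * Re (d (Suc i) * cnj (d i))"
    have Y: "of_real Y = d (Suc i) * cnj (d i) + d i * cnj (d (Suc i))"
      unfolding Y_def using complex_add_cnj[of "d (Suc i) * cnj (d i)"] by (simp add: mult.commute)
    have "\<bar>Y\<bar> \<le> 2 * (cmod (d (Suc i)) * cmod (d i))"
      unfolding Y_def using abs_Re_le_cmod[of "d (Suc i) * cnj (d i)"] by (simp add: norm_mult)
    also have "\<dots> \<le> cmod (d (Suc i)) ^ 2 + cmod (d i) ^ 2"
      using sum_squares_bound[of "cmod (d (Suc i))" "cmod (d i)"] by simp
    finally have "\<bar>X + Y\<bar> \<le> 2 * S (Suc i) - cmod (d 0) ^ 2 - cmod (d (Suc i)) ^ 2"
      using X(2) by (simp add: S_def)
    moreover have "\<tau> * of_real (S (Suc i)) =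
        \<alpha> * of_real (cmod (d 0) ^ 2) + of_real (X + Y) + d (Suc (Suc i)) * cnj (d (Suc i))"
    proof -
      have "\<tau> * of_real (S (Suc i)) = \<tau> * of_real (S i) + \<tau> * (d (Suc i) * cnj (d (Suc i)))"
        unfolding complex_norm_square[symmetric] by (simp add: S_def algebra_simps)
      thus ?thesis unfolding X(1) of_real_add Y rec by (simp add: algebra_simps)
    qed
    ultimately show ?case by blast
  qed
  obtain i where i: "m = Suc i" using zero d0 by (cases m) auto
  obtain X where "\<tau> * of_real (S i) = \<alpha> * of_real (cmod (d 0) ^ 2) + of_real X + d (Suc i) * cnj (d i)"
      "\<bar>X\<bar> \<le> 2 * S i - cmod (d 0) ^ 2 - cmod (d i) ^ 2"
    using *[of i] by blast
  hence X: "\<tau> * of_real (S i) = \<alpha> * of_real (cmod (d 0) ^ 2) + of_real X"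
      "\<bar>X\<bar> \<le> 2 * S i - cmod (d 0) ^ 2"
    using zero zero_le_power2[of "cmod (d i)"] unfolding i by (simp, linarith)
  have "cmod (d 0) ^ 2 \<le> S i"
    unfolding S_def by (rule member_le_sum) auto
  moreover have "cmod (d 0) ^ 2 > 0" using d0 by simp
  ultimately have S: "S i > 0" by linarith
  show ?thesis
  proof (rule that)
    show "\<tau> = of_real (X / S i) + of_real (cmod (d 0) ^ 2 / S i) * \<alpha>"
      using X(1) S by (simp add: field_simps)
    show "cmod (d 0) ^ 2 / S i \<ge> 0" using S by simp
    show "\<bar>X / S i\<bar> \<le> 2 - cmod (d 0) ^ 2 / S i"
      using X(2) S by (simp add: field_simps)
  qed
qed

lemma cf_iter_denom_zero:
  fixes q :: complex
  assumes zero: "snd (cf_iter q n e j) = 0" and q: "q \<noteq> 0" "cmod q < 1" and n: "n \<ge> 1"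
  obtains t s :: real
    where "1 + q * geom q n ^ 2 + q ^ (2 * n) = q ^ n * (of_real t + of_real s * q ^ n)"
      "s \<ge> 0" "\<bar>t\<bar> \<le> 2 - s"
proof -
  define T where "T = 1 + q * geom q n ^ 2 + q ^ (2 * n)"
  \<comment> \<open>The loop weight is read off the first step: \<open>D (Suc 0) = T * D 0\<close>
    for even length, while for odd length \<open>D 0 = 1\<close> and
    \<open>D (Suc 0) = T - q ^ (2 * n)\<close>.\<close>
  define \<alpha> where "\<alpha> = (if e then 0 else q ^ n)"
  define D where "D i = snd (cf_iter q n e i)" for i
  \<comment> \<open>This scaling turns the coefficient \<open>q ^ (2 * n)\<close> of the recurrence
    into 1.\<close>
  define d where "d i = D i / (q ^ n) ^ i" for i
  have qn: "q ^ n \<noteq> 0" using q by simp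
  have "geom q n \<noteq> 0"
  proof
    assume "geom q n = 0"
    hence "q ^ n = 1"
      using one_diff_power_eq[of q n] by (simp add: geom_def)
    hence "cmod q ^ n = 1" by (metis norm_one norm_power)
    thus False using q n power_less_one_iff[of "cmod q" n] by simp
  qed
  hence "D 0 \<noteq> 0" by (simp add: D_def cf_iter_0 cf_start_def)
  have D1: "D (Suc 0) = (T - \<alpha> * q ^ n) * D 0"
  proof (cases e)
    case True
    have "q * q ^ (2 * n - 1) = q ^ (2 * n)" using n by (simp flip: power_Suc)
    hence "q * N * (N ^ 2 + q ^ (2 * n - 1)) = (q * N ^ 2 + q ^ (2 * n)) * N" for N
      unfolding distrib_left distrib_right mult.assoc[symmetric] by (simp add: mult_ac)
    thus ?thesis using True
      by (simp add: D_def cf_iter_0 cf_iter_Suc cf_step_def cf_start_def T_def \<alpha>_def distrib_right)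
  next
    case False
    have "q ^ n * q ^ n = q ^ (2 * n)" by (simp add: mult_2 power_add)
    thus ?thesis using False
      by (simp add: D_def cf_iter_0 cf_iter_Suc cf_step_def cf_start_def T_def \<alpha>_def power2_eq_square)
  qed
  have D: "D (Suc (Suc i)) = T * D (Suc i) - (q ^ n) ^ 2 * D i" for i
    unfolding D_def T_def cf_iter_denom_recurrence by (simp add: power_mult[symmetric] mult.commute)
  obtain t s :: real where ts: "T / q ^ n = of_real t + of_real s * \<alpha>" "s \<ge> 0" "\<bar>t\<bar> \<le> 2 - s"
  proof (rule path_eigenvalue[of d "T / q ^ n" \<alpha> j])
    show "d 0 \<noteq> 0" using \<open>D 0 \<noteq> 0\<close> by (simp add: d_def)
    show "d (Suc 0) = (T / q ^ n - \<alpha>) * d 0"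
      using qn unfolding d_def D1 by (simp add: field_simps)
    show "d (Suc (Suc i)) = T / q ^ n * d (Suc i) - d i" for i
      using qn unfolding d_def D by (simp add: field_simps power2_eq_square)
    show "d j = 0" using zero by (simp add: d_def D_def)
  qed
  have "T = q ^ n * (of_real t + of_real s * \<alpha>)"
    using ts(1) qn by (simp add: field_simps)
  \<comment> \<open>For \<open>\<alpha> = 0\<close> the second coefficient is replaced by 0, and the
    bound on \<open>t\<close> only weakens.\<close>
  thus ?thesis
    using that[of t s] that[of t 0] ts(2,3) by (cases e) (auto simp: T_def \<alpha>_def)
qed

text \<open>For \<open>n = 1\<close> the imaginary part forces \<open>q\<close> to be real.\<close>

lemma no_zero_1:
  fixes q :: complex and t s :: real
  assumes eq: "1 + q + q ^ 2 = q * (of_real t + of_real s * q)"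
    and ts: "s \<ge> 0" "\<bar>t\<bar> \<le> 2 - s"
  shows "cmod q \<ge> (3 - sqrt 5) / 2"
proof (rule ccontr)
  assume "\<not> ?thesis"
  hence r: "cmod q < (3 - sqrt 5) / 2" by simp
  have sqrt5: "sqrt 5 > 2" "sqrt 5 * sqrt 5 = 5" by (simp_all add: real_less_rsqrt)
  hence r1: "cmod q < 1/2" using r by simp
  obtain x y where q: "q = Complex x y" by (cases q)
  have re: "1 + x + x^2 - y^2 = t * x + s * (x^2 - y^2)"
    and im: "y + 2 * x * y = t * y + 2 * s * x * y"
    using eq by (simp_all add: q complex_eq_iff power2_eq_square algebra_simps)
  have r2: "x^2 + y^2 < 1"
  proof -
    have "cmod q ^ 2 < 1" using r1 by (simp add: power_less_one_iff)
    thus ?thesis by (simp add: q cmod_power2)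
  qed
  \<comment> \<open>This is the imaginary part of the equation multiplied by \<open>cnj q\<close>,
    in which \<open>t\<close> cancels.\<close>
  have "y * (1 - (1 - s) * (x^2 + y^2)) = 0"
  proof -
    have "x * (y + 2 * x * y) - y * (1 + x + x^2 - y^2) =
          x * (t * y + 2 * s * x * y) - y * (t * x + s * (x^2 - y^2))"
      using re im by simp
    thus ?thesis by (simp add: algebra_simps power2_eq_square)
  qed
  moreover have "1 - (1 - s) * (x^2 + y^2) > 0"
  proof -
    have "s * (x^2 + y^2) \<ge> 0" using ts by simp
    thus ?thesis using r2 by (simp add: algebra_simps)
  qed
  ultimately have y: "y = 0" by simp
  hence a: "cmod q = \<bar>x\<bar>" by (simp add: q cmod_def)
  have "1 - \<bar>x\<bar> + \<bar>x\<bar>^2 \<le> 1 + x + x^2" by simp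
  also have "\<dots> = x * (t + s * x)" using re y by (simp add: power2_eq_square algebra_simps)
  also have "\<dots> \<le> \<bar>x\<bar> * \<bar>t + s * x\<bar>" by (metis abs_ge_self abs_mult)
  also have "\<dots> \<le> \<bar>x\<bar> * 2"
  proof (rule mult_left_mono)
    have "\<bar>s * x\<bar> \<le> s" using r1 a ts mult_left_mono[of "\<bar>x\<bar>" 1 s] by (simp add: abs_mult)
    thus "\<bar>t + s * x\<bar> \<le> 2" using ts by linarith
  qed simp
  \<comment> \<open>This is 1 - 3|x| + |x|^2 <= 0 in factored form; the smaller root is the claimed
    radius.\<close>
  finally have "(\<bar>x\<bar> - (3 - sqrt 5) / 2) * (\<bar>x\<bar> - (3 + sqrt 5) / 2) \<le> 0"
    using sqrt5 by (simp add: field_simps power2_eq_square)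
  moreover have "(\<bar>x\<bar> - (3 - sqrt 5) / 2) * (\<bar>x\<bar> - (3 + sqrt 5) / 2) > 0"
    using r a sqrt5 by (intro mult_neg_neg) auto
  ultimately show False by simp
qed

text \<open>Squared and written in Re q and |q|^2, the claim becomes nonnegativity of a quadratic in
  Re q. The factor 16/25 is large enough for the numerical contradiction in
  \<open>no_zero_ge_2\<close>.\<close>

lemma cmod_quadratic_ge:
  assumes "cmod q ^ 2 \<le> 146 / 1000"
  shows "cmod (1 - q + q ^ 2) \<ge> 16 / 25 * cmod (1 - q) ^ 2"
proof -
  obtain x y where q: "q = Complex x y" by (cases q)
  define p where "p = x^2 + y^2"
  have p: "0 \<le> p" "p \<le> 146 / 1000" using assms by (simp_all add: p_def q cmod_power2)
  have \<rho>: "cmod (1 - q) ^ 2 = 1 + p - 2 * x"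
    by (simp add: q cmod_power2 p_def) (simp add: power2_eq_square algebra_simps)
  have "cmod (1 - q + q ^ 2) ^ 2 = (1 + p - 2 * x) ^ 2 + 2 * (1 + p) * x - 3 * p"
    by (simp add: q cmod_power2 p_def) (simp add: power2_eq_square algebra_simps)
  also have "\<dots> = (16 / 25 * (1 + p - 2 * x)) ^ 2 +
      (369 / 625 * (1 + p - 2 * x) ^ 2 + 2 * (1 + p) * x - 3 * p)"
  proof -
    have "w ^ 2 = (16 / 25 * w) ^ 2 + 369 / 625 * w ^ 2" for w :: real
      by (simp add: power2_eq_square)
    from this[of "1 + p - 2 * x"] show ?thesis by linarith
  qed
  also have "\<dots> \<ge> (16 / 25 * (1 + p - 2 * x)) ^ 2"
  proof -
    define w where "w = 1 + p"
    \<comment> \<open>Up to the factor 625 * 1476, this square completes the square in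
      \<open>x\<close> of the expression to be bounded.\<close>
    have "(1476 * x - 113 * w) ^ 2 = 2178576 * x ^ 2 - 333576 * (x * w) + 12769 * w ^ 2"
      "(w - 2 * x) ^ 2 = w ^ 2 - 4 * (x * w) + 4 * x ^ 2"
      by (simp_all add: power2_eq_square algebra_simps)
    moreover have "(1476 * x - 113 * w) ^ 2 \<ge> 0" by simp
    moreover have "w ^ 2 \<ge> 1 + 2 * p" by (simp add: w_def power2_eq_square algebra_simps)
    ultimately have "369 / 625 * (w - 2 * x) ^ 2 + 2 * (x * w) - 3 * p \<ge> 0" using p by linarith
    thus ?thesis by (simp add: w_def mult_ac)
  qed
  finally show ?thesis unfolding \<rho> by (rule power2_le_imp_le) simp
qed

text \<open>Multiplied by (1 - q)^2, the equation equates (1 - q + q^2)(1 + q^(2n)) with terms that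
  are too small when |q| < 0.382. This rational bound lies just above (3 - sqrt 5)/2.\<close>

lemma no_zero_ge_2:
  fixes q :: complex and t s :: real
  assumes n: "n \<ge> 2" and eq: "1 + q * geom q n ^ 2 + q ^ (2 * n) = q ^ n * (of_real t + of_real s * q ^ n)"
    and ts: "s \<ge> 0" "\<bar>t\<bar> \<le> 2 - s"
  shows "cmod q \<ge> 382 / 1000"
proof (rule ccontr)
  assume less: "\<not> ?thesis"
  define r where "r = cmod q"
  have r: "0 \<le> r" "r < 382 / 1000" using less by (simp_all add: r_def)
  \<comment> \<open>The decimals are rounded safely: 0.146 exceeds 0.382^2, 0.381 is below 0.618^2,
    and 0.97 is below 1 - 0.146^2.\<close>
  have r2: "r ^ 2 \<le> 146 / 1000"
    using power_mono[of r "382 / 1000" 2] r by (simp add: power2_eq_square)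
  have rn: "r ^ n \<le> r ^ 2" using n r by (intro power_decreasing) auto
  define \<rho> where "\<rho> = cmod (1 - q) ^ 2"
  have "1 - r \<le> cmod (1 - q)" unfolding r_def using norm_triangle_ineq2[of 1 q] by simp
  hence "(618 / 1000) ^ 2 \<le> \<rho>" unfolding \<rho>_def using r by (intro power_mono) auto
  hence \<rho>: "\<rho> \<ge> 381 / 1000" by (simp add: power2_eq_square)
  have "cmod (of_real t + of_real s * q ^ n) \<le> \<bar>t\<bar> + s * r ^ n"
    using norm_triangle_ineq[of "of_real t" "of_real s * q ^ n"] ts
    by (simp add: norm_mult norm_power r_def)
  also have "\<dots> \<le> 2"
  proof -
    have "s * r ^ n \<le> s * 1" using ts r by (intro mult_left_mono power_le_one) auto
    thus ?thesis using ts by simp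
  qed
  finally have ts2: "cmod (of_real t + of_real s * q ^ n) \<le> 2" .
  have "(1 - q) * geom q n = 1 - q ^ n" by (simp add: geom_def one_diff_power_eq)
  hence "(1 - q) ^ 2 * geom q n ^ 2 = (1 - q ^ n) ^ 2" by (simp flip: power_mult_distrib)
  hence "(1 - q) ^ 2 * (1 + q * geom q n ^ 2 + q ^ (2 * n)) =
      (1 - q) ^ 2 * (1 + q ^ (2 * n)) + q * (1 - q ^ n) ^ 2"
    by (simp add: distrib_left mult.left_commute[of _ q])
  moreover have "(1 - q) ^ 2 * (1 + z ^ 2) + q * (1 - z) ^ 2 = (1 - q + q ^ 2) * (1 + z ^ 2) - 2 * q * z" for z
    by (simp add: algebra_simps power2_eq_square)
  ultimately have "(1 - q + q ^ 2) * (1 + q ^ (2 * n)) =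
      2 * q * q ^ n + (1 - q) ^ 2 * (q ^ n * (of_real t + of_real s * q ^ n))"
    unfolding eq unfolding power_even_eq by simp
  hence "cmod (1 - q + q ^ 2) * cmod (1 + q ^ (2 * n)) \<le>
      2 * r * r ^ n + \<rho> * (r ^ n * cmod (of_real t + of_real s * q ^ n))"
    unfolding \<rho>_def r_def norm_mult[symmetric] norm_power[symmetric]
    using norm_triangle_ineq[of "2 * q * q ^ n"
        "(1 - q) ^ 2 * (q ^ n * (of_real t + of_real s * q ^ n))"]
    by (simp add: norm_mult norm_power)
  also have "\<dots> \<le> 2 * (382 / 1000) * (146 / 1000) + \<rho> * (146 / 1000 * 2)"
    using r r2 rn \<rho> ts2 by (intro add_mono mult_mono) auto
  finally have upper: "cmod (1 - q + q ^ 2) * cmod (1 + q ^ (2 * n)) \<le>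
      2 * (382 / 1000) * (146 / 1000) + \<rho> * (146 / 1000 * 2)" .
  have "r ^ (2 * n) = r ^ n * r ^ n" by (simp add: mult_2 power_add)
  also have "\<dots> \<le> 146 / 1000 * (146 / 1000)" using r r2 rn by (intro mult_mono) auto
  finally have "cmod (1 + q ^ (2 * n)) \<ge> 97 / 100"
    using norm_diff_ineq[of 1 "q ^ (2 * n)"] by (simp add: norm_power r_def)
  moreover have "cmod (1 - q + q ^ 2) \<ge> 16 / 25 * \<rho>"
    unfolding \<rho>_def using r2 by (intro cmod_quadratic_ge) (simp add: r_def)
  ultimately have "16 / 25 * \<rho> * (97 / 100) \<le> cmod (1 - q + q ^ 2) * cmod (1 + q ^ (2 * n))"
    using \<rho> by (intro mult_mono) auto
  thus False using upper \<rho> by simp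
qed

lemma cf_iter_denom_nonzero:
  fixes q :: complex
  assumes n: "n \<ge> 1" and q: "cmod q < (3 - sqrt 5) / 2"
  shows "snd (cf_iter q n e j) \<noteq> 0"
proof (cases "q = 0")
  case True
  thus ?thesis using n by (simp add: cf_iter_at_0)
next
  case False
  have "sqrt 5 \<ge> 2236 / 1000" by (rule real_le_rsqrt) (simp add: power2_eq_square)
  hence q': "cmod q < 382 / 1000" using q by simp
  show ?thesis
  proof
    assume "snd (cf_iter q n e j) = 0"
    then obtain t s :: real
      where *: "1 + q * geom q n ^ 2 + q ^ (2 * n) = q ^ n * (of_real t + of_real s * q ^ n)"
        "s \<ge> 0" "\<bar>t\<bar> \<le> 2 - s"
      using q' False n by (elim cf_iter_denom_zero) auto
    show False
    proof (cases "n = 1")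
      case True
      thus False using * no_zero_1[of q t s] q by (simp add: geom_def)
    next
      case False
      thus False using * no_zero_ge_2[of n q t s] n q' by simp
    qed
  qed
qed

section \<open>The radius of convergence\<close>

text \<open>Passing to lowest terms creates no new zeros: by coprimality the reduced denominator
  divides \<open>Q\<close>, so it is nonzero on the same disc and in particular at 0.\<close>

lemma fps_conv_radius_taylor_fract:
  fixes P Q :: "complex poly"
  assumes "r > 0" and nz: "\<And>z. cmod z < r \<Longrightarrow> poly Q z \<noteq> 0"
  shows "fps_conv_radius (taylor_fract (to_fract P / to_fract Q)) \<ge> ereal r"
proof -
  define f where "f = to_fract P / to_fract Q"
  obtain P' Q' where PQ': "quot_of_fract f = (P', Q')" by fastforce
  have "Q \<noteq> 0" using nz[of 0] assms(1) by auto
  have "Q' \<noteq> 0" "coprime P' Q'" "to_fract P' / to_fract Q' = f"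
    using snd_quot_of_fract_nonzero[of f] coprime_quot_of_fract[of f] Fract_quot_of_fract[of f]
    by (simp_all add: PQ' Fract_conv_to_fract)
  hence "to_fract (P' * Q) = to_fract (P * Q')"
    using \<open>Q \<noteq> 0\<close> by (simp add: f_def field_simps)
  hence "Q' dvd P' * Q" by (simp only: to_fract_eq_iff) simp
  hence "Q' dvd Q" using \<open>coprime P' Q'\<close> by (simp add: coprime_commute coprime_dvd_mult_right_iff)
  hence nz': "poly Q' z \<noteq> 0" if "cmod z < r" for z
    using nz[OF that] by auto
  have "subdegree (fps_of_poly Q') = 0"
    using nz'[of 0] assms(1) by (intro subdegree_eq_0) (simp add: poly_0_coeff_0)
  hence "fps_conv_radius (fps_of_poly P' / fps_of_poly Q') \<ge>
      Min {ereal r, fps_conv_radius (fps_of_poly P'), fps_conv_radius (fps_of_poly Q')}"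
    using assms(1) nz' by (intro fps_conv_radius_divide) auto
  thus ?thesis by (simp add: taylor_fract_def PQ' flip: f_def)
qed

theorem theorem1p3:
  fixes n k :: nat and x :: rat
  assumes "n \<ge> 1" and "k \<ge> 1"
    and "x = reg_cf (replicate k n)"
  shows "fps_conv_radius (taylor_fract (q_rational x)) \<ge> ereal ((3 - sqrt 5) / 2)"
proof -
  define e j where "e = even k" and "j = (k - 1) div 2"
  have k: "k = 2 * j + (if e then 2 else 1)"
    using \<open>k \<ge> 1\<close> unfolding e_def j_def by (cases "even k") (auto elim!: evenE oddE)
  define P Q :: "complex poly"
    where "P = fst (cf_iter [:0, 1:] n e j)" and "Q = snd (cf_iter [:0, 1:] n e j)"
  have nz: "fst (cf_iter [:0, 1 :: complex:] n e i) \<noteq> 0"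
    "snd (cf_iter [:0, 1 :: complex:] n e i) \<noteq> 0" for i
    using poly_cf_iter_0[OF assms(1), where 'a = complex] by (metis poly_0 zero_neq_one)+
  have "q_rational x = q_cf (to_fract [:0, 1:]) (replicate k n)"
    unfolding assms(3) using assms(1,2) by (intro q_rational_reg_cf) auto
  also have "\<dots> = to_fract P / to_fract Q"
    unfolding k P_def Q_def using assms(1) nz
    by (subst q_cf_replicate) (simp_all add: cf_iter_to_fract)
  finally have x: "q_rational x = to_fract P / to_fract Q" .
  show ?thesis
    unfolding x
  proof (rule fps_conv_radius_taylor_fract)
    have "sqrt 5 < 3" by (rule real_less_lsqrt) simp_all
    thus "(3 - sqrt 5) / 2 > 0" by simp
    show "poly Q z \<noteq> 0" if "cmod z < (3 - sqrt 5) / 2" for z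
      using cf_iter_denom_nonzero[OF assms(1) that, of e j] cf_iter_poly[of z n e j] by (simp add: Q_def)
  qed
qed

end
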